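(* Every $3$-coloring of the edges of $K_{\mathbb{N}}$ contains a monochromatic connected subgraph $T$ with $\bar{d}_s(T)\geq 1/2$.
   Context: $K_{\mathbb{N}}$ is the complete graph on the positive integers $\mathbb{N}$; a $3$-coloring is a partition of its edges into three color classes, and a monochromatic subgraph is one all of whose edges have the same color. For an infinite sequence $A=(a_1,a_2,\dots)$ of distinct positive integers, let $f(n)=\sup\{m:\{a_1,\dots,a_m\}\subseteq\{1,\dots,n\}\}$ and $\bar{d}_s(A)=\limsup_{n\to\infty}f(n)/n$. For a connected subgraph $T$ of $K_{\mathbb{N}}$, its strong upper density is $\bar{d}_s(T)=\sup_{V\in\pi}\bar{d}_s(V)$, where $\pi$ is the set of all orderings $(v_1,v_2,\dots)$ of $V(T)$ such that for every $k\geq 1$ the subgraph of $T$ induced by $\{v_1,\dots,v_k\}$ is connected. *)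

theory Defs
  imports "HOL-Library.Extended_Real" "HOL-Library.Liminf_Limsup"
begin

text \<open>A graph is given by its vertex set and its set of edges, an edge being a two-element
  set of vertices.\<close>

type_synonym 'a graph = "'a set \<times> 'a set set"

abbreviation verts :: "'a graph \<Rightarrow> 'a set" where
  "verts G \<equiv> fst G"

abbreviation edges :: "'a graph \<Rightarrow> 'a set set" where
  "edges G \<equiv> snd G"

definition simple_graph :: "'a graph \<Rightarrow> bool" where
  "simple_graph G \<longleftrightarrow> (\<forall>e\<in>edges G. e \<subseteq> verts G \<and> card e = 2)"

definition is_subgraph :: "'a graph \<Rightarrow> 'a graph \<Rightarrow> bool" where
  "is_subgraph H G \<longleftrightarrow> simple_graph H \<and> verts H \<subseteq> verts G \<and> edges H \<subseteq> edges G"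

definition induced_subgraph :: "'a graph \<Rightarrow> 'a set \<Rightarrow> 'a graph" where
  "induced_subgraph G S = (verts G \<inter> S, {e \<in> edges G. e \<subseteq> S})"

definition connected_graph :: "'a graph \<Rightarrow> bool" where
  "connected_graph G \<longleftrightarrow> verts G \<noteq> {} \<and>
     (\<forall>u\<in>verts G. \<forall>v\<in>verts G. (u, v) \<in> {(x, y). {x, y} \<in> edges G}\<^sup>*)"

definition complete_graph :: "'a set \<Rightarrow> 'a graph" where
  "complete_graph V = (V, {e. e \<subseteq> V \<and> card e = 2})"

definition K_nat :: "nat graph" where
  "K_nat = complete_graph {n. n \<ge> 1}"

text \<open>A partition of the edges into \<open>k\<close> colour classes is given by the map sending each edge to
  the index of its class. Colour classes may be empty.\<close>

definition edge_coloring :: "nat \<Rightarrow> 'a graph \<Rightarrow> ('a set \<Rightarrow> nat) \<Rightarrow> bool" where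
  "edge_coloring k G c \<longleftrightarrow> (\<forall>e\<in>edges G. c e \<in> {1..k})"

definition monochromatic :: "('a set \<Rightarrow> nat) \<Rightarrow> 'a graph \<Rightarrow> bool" where
  "monochromatic c H \<longleftrightarrow> (\<exists>i. \<forall>e\<in>edges H. c e = i)"

text \<open>Sequences are indexed from 0: the term \<open>a\<^sub>k\<close> of \<open>(a\<^sub>1, a\<^sub>2, \<dots>)\<close> is \<open>a (k - 1)\<close>, so
  \<open>{a\<^sub>1, \<dots>, a\<^sub>m}\<close> is \<open>a ` {..<m}\<close>. For injective \<open>a\<close> the set in the following definition contains 0
  and is bounded by \<open>n\<close>, so its supremum in the natural numbers is a genuine one.\<close>

definition prefix_count :: "(nat \<Rightarrow> nat) \<Rightarrow> nat \<Rightarrow> nat" where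
  "prefix_count a n = Sup {m. a ` {..<m} \<subseteq> {1..n}}"

definition seq_strong_upper_density :: "(nat \<Rightarrow> nat) \<Rightarrow> ereal" where
  "seq_strong_upper_density a = limsup (\<lambda>n. ereal (real (prefix_count a n) / real n))"

definition connected_orderings :: "'a graph \<Rightarrow> (nat \<Rightarrow> 'a) set" where
  "connected_orderings T = {v. bij_betw v UNIV (verts T) \<and>
     (\<forall>k\<ge>1. connected_graph (induced_subgraph T (v ` {..<k})))}"

text \<open>A finite graph has no infinite ordering, so its density is the supremum of the empty set,
  which is \<open>-\<infinity>\<close> in the extended reals; a lower bound on the density thus forces the graph to be
  infinite.\<close>

definition strong_upper_density :: "nat graph \<Rightarrow> ereal" where
  "strong_upper_density T = (SUP v\<in>connected_orderings T. seq_strong_upper_density v)"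

end

theory Submission
  imports Defs
begin

text \<open>The strong upper density of the monochromatic component of a vertex \<open>v\<close> is governed by
  the sizes of the components \<open>C\<^sub>n(v)\<close> of \<open>v\<close> in the colour class restricted to \<open>{1..n}\<close>: the ordering which always appends the
  least vertex adjacent to the vertices chosen so far runs through each \<open>C\<^sub>n(v)\<close> before leaving it.
  So one needs a colour and a vertex \<open>v\<close> with \<open>\<bar>C\<^sub>n(v)\<bar> \<ge> n / 2\<close> for infinitely many \<open>n\<close>.

  Let \<open>A\<^sub>1, A\<^sub>2, A\<^sub>3\<close> be the three components of the vertex 1 in \<open>{1..n}\<close>, which cover \<open>{1..n}\<close>. If they
  do not work, then for \<open>n \<ge> N\<close> each has fewer than \<open>n / 2\<close> elements, so no two of them
  cover \<open>{1..n}\<close>. A vertex in \<open>A\<^sub>1 \<inter> A\<^sub>2 - A\<^sub>3\<close> could not be joined to one outside \<open>A\<^sub>1 \<union> A\<^sub>2\<close>, so the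
  complement of \<open>A\<^sub>3\<close> splits into \<open>A\<^sub>1 - A\<^sub>2 - A\<^sub>3\<close> and \<open>A\<^sub>2 - A\<^sub>1 - A\<^sub>3\<close>, between which all edges have
  colour 3. Hence it lies in a single component of colour 3. A vertex \<open>u\<close> outside \<open>A\<^sub>3\<close> at time \<open>N\<close>
  never enters \<open>A\<^sub>3\<close> later, since it would bring the whole complement along; so the component
  of \<open>u\<close> in colour 3 has more than \<open>n / 2\<close> elements for all \<open>n \<ge> N\<close>.\<close>

section \<open>Connected components through the adjacency relation\<close>

definition adj :: "'a graph \<Rightarrow> ('a \<times> 'a) set" where
  "adj G = {(x, y). {x, y} \<in> edges G}"

definition component :: "'a graph \<Rightarrow> 'a \<Rightarrow> 'a set" where
  "component G v = (adj G)\<^sup>* `` {v}"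

lemma adj_sym: "(x, y) \<in> adj G \<Longrightarrow> (y, x) \<in> adj G"
  by (simp add: adj_def insert_commute)

lemma sym_rtrancl_adj: "sym ((adj G)\<^sup>*)"
  by (rule sym_rtrancl, rule symI, erule adj_sym)

lemma adj_induced_subgraph:
  "(x, y) \<in> adj (induced_subgraph G S) \<longleftrightarrow> (x, y) \<in> adj G \<and> x \<in> S \<and> y \<in> S"
  by (auto simp: adj_def induced_subgraph_def)

lemma self_in_component: "v \<in> component G v"
  by (simp add: component_def)

lemma component_adj: "x \<in> component G v \<Longrightarrow> (x, y) \<in> adj G \<Longrightarrow> y \<in> component G v"
  unfolding component_def by (auto intro: rtrancl_into_rtrancl)

text \<open>The component is the least set that contains \<open>v\<close> and is closed under
  adjacency. Most inclusions below come from this closure argument instead of from explicit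
  paths.\<close>

lemma component_subset:
  assumes "v \<in> S" "\<And>x y. x \<in> S \<Longrightarrow> (x, y) \<in> adj G \<Longrightarrow> y \<in> S"
  shows "component G v \<subseteq> S"
proof
  fix u assume "u \<in> component G v"
  then have "(v, u) \<in> (adj G)\<^sup>*" by (simp add: component_def)
  then show "u \<in> S" by induction (use assms in auto)
qed

lemma component_mono: "adj G \<subseteq> adj H \<Longrightarrow> component G v \<subseteq> component H v"
  by (rule component_subset) (auto intro: self_in_component component_adj)

lemma component_trans: "u \<in> component G v \<Longrightarrow> component G u \<subseteq> component G v"
  unfolding component_def by auto

lemma component_sym: "u \<in> component G v \<Longrightarrow> v \<in> component G u"
  unfolding component_def using sym_rtrancl_adj[of G] by (auto dest: symD)

lemma connected_graphI:
  assumes "v \<in> verts G" "verts G \<subseteq> component G v"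
  shows "connected_graph G"
  unfolding connected_graph_def adj_def[symmetric]
proof (intro conjI ballI)
  show "verts G \<noteq> {}" using assms by auto
  fix x y assume "x \<in> verts G" "y \<in> verts G"
  then have "v \<in> component G x" "y \<in> component G v"
    using assms(2) component_sym[of x G v] by blast+
  then have "y \<in> component G x" using component_trans[of v G x] by blast
  then show "(x, y) \<in> (adj G)\<^sup>*" by (simp add: component_def)
qed

text \<open>A walk of \<open>H\<close> from \<open>v\<close> never leaves
  \<open>component G v\<close>, so only edges inside that set have to survive in \<open>K\<close>.
  It serves to pass from a colour class to the subgraph induced on one of its components without
  losing vertices.\<close>

lemma component_subset_restrict:
  assumes "adj H \<subseteq> adj G"
    and "\<And>x y. (x, y) \<in> adj H \<Longrightarrow> x \<in> component G v \<Longrightarrow> y \<in> component G v \<Longrightarrow> (x, y) \<in> adj K"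
  shows "component H v \<subseteq> component K v"
proof -
  have "component H v \<subseteq> component K v \<inter> component G v"
  proof (rule component_subset)
    fix x y assume x: "x \<in> component K v \<inter> component G v" and xy: "(x, y) \<in> adj H"
    then have y: "y \<in> component G v" using assms(1) component_adj[of x G v y] by blast
    with x xy have "(x, y) \<in> adj K" using assms(2) by blast
    then show "y \<in> component K v \<inter> component G v" using x y component_adj[of x K v y] by blast
  qed (simp add: self_in_component)
  then show ?thesis by blast
qed

lemma component_initial_subset:
  "v \<le> n \<Longrightarrow> component (induced_subgraph G {..n}) v \<subseteq> {..n::nat}"
  by (rule component_subset) (auto simp: adj_induced_subgraph)

section \<open>The greedy ordering of a component\<close>

definition greedy_next :: "nat graph \<Rightarrow> nat \<Rightarrow> nat set \<Rightarrow> nat" where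
  "greedy_next T v S = (if S = {} then v else LEAST y. y \<notin> S \<and> (\<exists>x\<in>S. (x, y) \<in> adj T))"

primrec greedy_set :: "nat graph \<Rightarrow> nat \<Rightarrow> nat \<Rightarrow> nat set" where
  "greedy_set T v 0 = {}"
| "greedy_set T v (Suc k) = insert (greedy_next T v (greedy_set T v k)) (greedy_set T v k)"

definition greedy_seq :: "nat graph \<Rightarrow> nat \<Rightarrow> nat \<Rightarrow> nat" where
  "greedy_seq T v k = greedy_next T v (greedy_set T v k)"

lemma greedy_seq_image: "greedy_seq T v ` {..<k} = greedy_set T v k"
  by (induction k) (auto simp: greedy_seq_def lessThan_Suc)

lemma start_in_greedy_set: "0 < k \<Longrightarrow> v \<in> greedy_set T v k"
proof (induction k)
  case (Suc k) then show ?case by (cases k) (auto simp: greedy_next_def)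
qed simp

text \<open>The edge from \<open>x\<close> to \<open>y\<close> leaving \<open>S\<close> is a witness
  for the \<open>LEAST\<close> in \<open>greedy_next\<close>, whose value is unspecified without
  one.\<close>

lemma greedy_next_spec:
  assumes "S \<noteq> {}" "x \<in> S" "y \<notin> S" "(x, y) \<in> adj T"
  shows "greedy_next T v S \<notin> S" "\<exists>x\<in>S. (x, greedy_next T v S) \<in> adj T" "greedy_next T v S \<le> y"
proof -
  let ?P = "\<lambda>y. y \<notin> S \<and> (\<exists>x\<in>S. (x, y) \<in> adj T)"
  have *: "greedy_next T v S = (LEAST y. ?P y)" using assms by (simp add: greedy_next_def)
  have P: "?P y" using assms by blast
  show "greedy_next T v S \<notin> S" "\<exists>x\<in>S. (x, greedy_next T v S) \<in> adj T"
    using LeastI[of ?P, OF P] unfolding * by blast+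
  show "greedy_next T v S \<le> y" unfolding * by (rule Least_le[of ?P, OF P])
qed

text \<open>While part of the component within \<open>{..n}\<close> is still missing, some edge
  inside \<open>{..n}\<close> leaves the chosen set. The least candidate is then at most
  \<open>n\<close>, so the choice stays in that component.\<close>

lemma greedy_step:
  assumes "v \<le> n" "greedy_set T v k \<subset> component (induced_subgraph T {..n}) v" (is "?S \<subset> ?C")
  shows "greedy_next T v ?S \<in> ?C - ?S"
    and "0 < k \<Longrightarrow> \<exists>x\<in>?S. (x, greedy_next T v ?S) \<in> adj T"
proof -
  have *: "greedy_next T v ?S \<in> ?C - ?S \<and> (\<exists>x\<in>?S. (x, greedy_next T v ?S) \<in> adj T)" if "0 < k"
  proof -
    have v: "v \<in> ?S" using that by (rule start_in_greedy_set)
    \<comment> \<open>If no edge left the chosen set, \<open>component_subset\<close> would put the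
      whole component into it.\<close>
    then obtain x y where xy: "x \<in> ?S" "y \<notin> ?S" "(x, y) \<in> adj (induced_subgraph T {..n})"
      using component_subset[of v ?S] assms(2) by blast
    then have "(x, y) \<in> adj T" "y \<le> n" by (auto simp: adj_induced_subgraph)
    note spec = greedy_next_spec[OF _ xy(1,2) this(1), of v]
    obtain z where z: "z \<in> ?S" "(z, greedy_next T v ?S) \<in> adj T" using spec v by blast
    have "z \<le> n" using z(1) assms component_initial_subset by blast
    moreover have "greedy_next T v ?S \<le> n" using spec(3) \<open>y \<le> n\<close> v by force
    ultimately have "(z, greedy_next T v ?S) \<in> adj (induced_subgraph T {..n})"
      using z by (simp add: adj_induced_subgraph)
    moreover have "z \<in> ?C" using z(1) assms(2) by blast
    ultimately have "greedy_next T v ?S \<in> ?C" by (rule component_adj[rotated])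
    then show ?thesis using spec(1) v z by blast
  qed
  then show "0 < k \<Longrightarrow> \<exists>x\<in>?S. (x, greedy_next T v ?S) \<in> adj T" by blast
  show "greedy_next T v ?S \<in> ?C - ?S"
    using * by (cases k) (auto simp: greedy_next_def self_in_component)
qed

lemma greedy_set_initial:
  assumes "v \<le> n" "k \<le> card (component (induced_subgraph T {..n}) v)"
  shows "greedy_set T v k \<subseteq> component (induced_subgraph T {..n}) v \<and> card (greedy_set T v k) = k"
  using assms(2)
proof (induction k)
  case (Suc k)
  let ?S = "greedy_set T v k" and ?C = "component (induced_subgraph T {..n}) v"
  have fin: "finite ?C" using component_initial_subset[OF assms(1)] finite_subset by blast
  have IH: "?S \<subseteq> ?C" "card ?S = k" using Suc by auto
  then have "?S \<subset> ?C" using Suc.prems by auto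
  from greedy_step(1)[OF assms(1) this] show ?case
    using IH finite_subset[OF IH(1) fin] by auto
qed simp

text \<open>The components within \<open>{..n}\<close> grow with \<open>n\<close>, and their union
  is closed under adjacency because each edge lies in some \<open>{..n}\<close>. So they exhaust the
  full component.\<close>

lemma finite_subset_component_initial:
  fixes T :: "nat graph"
  assumes "finite S" "S \<subseteq> component T v"
  shows "\<exists>n\<ge>v. S \<subseteq> component (induced_subgraph T {..n}) v"
proof -
  have mono: "component (induced_subgraph T {..m}) v \<subseteq> component (induced_subgraph T {..n}) v"
    if "m \<le> n" for m n
    by (rule component_mono) (use that in \<open>auto simp: adj_induced_subgraph\<close>)
  have "component T v \<subseteq> (\<Union>n. component (induced_subgraph T {..n}) v)"
  proof (rule component_subset)
    fix x y assume "x \<in> (\<Union>n. component (induced_subgraph T {..n}) v)" and xy: "(x, y) \<in> adj T"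
    then obtain n where "x \<in> component (induced_subgraph T {..n}) v" by blast
    then have "x \<in> component (induced_subgraph T {..max n (max x y)}) v"
      using mono[of n "max n (max x y)"] by auto
    moreover have "(x, y) \<in> adj (induced_subgraph T {..max n (max x y)})"
      using xy by (auto simp: adj_induced_subgraph)
    ultimately have "y \<in> component (induced_subgraph T {..max n (max x y)}) v"
      by (rule component_adj)
    then show "y \<in> (\<Union>n. component (induced_subgraph T {..n}) v)" by blast
  qed (auto simp: self_in_component)
  then have sub: "S \<subseteq> (\<Union>n. component (induced_subgraph T {..n}) v)" using assms by blast
  from assms(1) this show ?thesis
  proof (induction S)
    case (insert s S)
    then obtain m n where "m \<ge> v" "S \<subseteq> component (induced_subgraph T {..m}) v"
      "s \<in> component (induced_subgraph T {..n}) v" by blast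
    then show ?case
      using mono[of m "max m n"] mono[of n "max m n"] by (intro exI[of _ "max m n"]) auto
  qed auto
qed

text \<open>The greedy order does not depend on \<open>n\<close>, yet each of these components is
  one of its initial segments. This turns component sizes into prefix counts.\<close>

lemma greedy_set_eq_component:
  assumes "v \<le> n"
  shows "greedy_set T v (card (component (induced_subgraph T {..n}) v))
           = component (induced_subgraph T {..n}) v"
proof (rule card_subset_eq)
  show "finite (component (induced_subgraph T {..n}) v)"
    using component_initial_subset[OF assms] finite_subset by blast
qed (use greedy_set_initial[OF assms order_refl] in blast)+

lemma prefix_count_ge:
  assumes "inj a" "a ` {..<m} \<subseteq> {1..n}"
  shows "m \<le> prefix_count a n"
  unfolding prefix_count_def
proof (rule cSup_upper)
  show "m \<in> {m. a ` {..<m} \<subseteq> {1..n}}" using assms by simp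
  show "bdd_above {m. a ` {..<m} \<subseteq> {1..n}}"
  proof (rule bdd_aboveI)
    fix k assume "k \<in> {m. a ` {..<m} \<subseteq> {1..n}}"
    then have "card (a ` {..<k}) \<le> card {1..n}" by (intro card_mono) auto
    then show "k \<le> n" using assms(1) by (simp add: card_image inj_on_subset)
  qed
qed

text \<open>As \<open>T\<close> is infinite, the components within \<open>{..n}\<close> become
  arbitrarily large, so the greedy choice never stalls. Every vertex is reached, since it lies in
  one of these components and each of them is exhausted.\<close>

lemma greedy_seq_connected_ordering:
  assumes "verts T = component T v" "infinite (verts T)"
  shows "greedy_seq T v \<in> connected_orderings T"
proof -
  let ?S = "greedy_set T v" and ?C = "\<lambda>n. component (induced_subgraph T {..n}) v"
  have C_sub: "?C n \<subseteq> verts T" for n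
    unfolding assms(1) by (rule component_mono) (auto simp: adj_induced_subgraph)
  have large: "\<exists>n\<ge>v. k < card (?C n)" for k
  proof -
    obtain B where B: "B \<subseteq> verts T" "finite B" "card B = Suc k"
      using infinite_arbitrarily_large[OF assms(2)] by metis
    then obtain n where n: "n \<ge> v" "B \<subseteq> ?C n"
      using finite_subset_component_initial[of B T v] assms(1) by metis
    then have "finite (?C n)" using component_initial_subset[OF n(1)] finite_subset by blast
    from card_mono[OF this n(2)] show ?thesis using B(3) n(1) by (intro exI[of _ n]) simp
  qed
  have step: "\<exists>n\<ge>v. ?S k \<subset> ?C n" for k
  proof -
    obtain n where n: "n \<ge> v" "k < card (?C n)" using large by blast
    then have "?S k \<subseteq> ?C n \<and> card (?S k) = k" by (intro greedy_set_initial) auto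
    then show ?thesis using n by (intro exI[of _ n]) auto
  qed
  have sub: "?S k \<subseteq> verts T" for k using step C_sub by (meson order_trans psubset_imp_subset)
  have fresh: "greedy_seq T v k \<notin> ?S k" for k
    using step greedy_step(1) unfolding greedy_seq_def by blast
  have "inj (greedy_seq T v)"
  proof (rule linorder_injI)
    fix j k :: nat assume "j < k"
    then have "greedy_seq T v j \<in> ?S k" unfolding greedy_seq_image[symmetric] by simp
    then show "greedy_seq T v j \<noteq> greedy_seq T v k" using fresh by metis
  qed
  moreover have "range (greedy_seq T v) = verts T"
  proof
    show "range (greedy_seq T v) \<subseteq> verts T"
      using sub[of "Suc _"] by (auto simp: greedy_seq_def)
    show "verts T \<subseteq> range (greedy_seq T v)"
    proof
      fix x assume "x \<in> verts T"
      then obtain n where "n \<ge> v" "x \<in> ?C n"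
        using finite_subset_component_initial[of "{x}" T v] assms(1) by auto
      then show "x \<in> range (greedy_seq T v)"
        using greedy_set_eq_component[of v n T] greedy_seq_image[of T v] by blast
    qed
  qed
  moreover have "connected_graph (induced_subgraph T (greedy_seq T v ` {..<k}))" if "k \<ge> 1" for k
    unfolding greedy_seq_image
  proof (rule connected_graphI[of v])
    have "v \<in> ?S k" using that by (intro start_in_greedy_set) auto
    then show "v \<in> verts (induced_subgraph T (?S k))" using sub by (auto simp: induced_subgraph_def)
    have "?S k \<subseteq> component (induced_subgraph T (?S k)) v"
    proof (induction k)
      case (Suc k)
      let ?D = "component (induced_subgraph T (?S (Suc k))) v"
      have IH: "?S k \<subseteq> ?D"
        by (rule order_trans[OF Suc component_mono]) (auto simp: adj_induced_subgraph)
      have "greedy_next T v (?S k) \<in> ?D"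
      proof (cases "k = 0")
        case True then show ?thesis by (simp add: greedy_next_def self_in_component)
      next
        case False
        then obtain x where x: "x \<in> ?S k" "(x, greedy_next T v (?S k)) \<in> adj T"
          using step greedy_step(2) by blast
        then have "(x, greedy_next T v (?S k)) \<in> adj (induced_subgraph T (?S (Suc k)))"
          by (simp add: adj_induced_subgraph)
        moreover have "x \<in> ?D" using x(1) IH by blast
        ultimately show ?thesis by (rule component_adj[rotated])
      qed
      then show ?case using IH by simp
    qed simp
    then show "verts (induced_subgraph T (?S k)) \<subseteq> component (induced_subgraph T (?S k)) v"
      by (auto simp: induced_subgraph_def)
  qed
  ultimately show ?thesis unfolding connected_orderings_def bij_betw_def mem_Collect_eq
    by (intro conjI allI impI)
qed

section \<open>From component sizes to strong upper density\<close>

lemma strong_upper_density_ge_half: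
  assumes "verts T = component T v" "0 \<notin> verts T"
    and freq: "\<exists>\<^sub>F n in sequentially. n \<le> 2 * card (component (induced_subgraph T {..n}) v)"
  shows "strong_upper_density T \<ge> 1 / 2"
proof -
  let ?C = "\<lambda>n. component (induced_subgraph T {..n}) v"
  have C_sub: "?C n \<subseteq> verts T" for n
    unfolding assms(1) by (rule component_mono) (auto simp: adj_induced_subgraph)
  have "infinite (verts T)"
  proof
    assume fin: "finite (verts T)"
    obtain n where "n \<ge> Suc (2 * card (verts T))" "n \<le> 2 * card (?C n)"
      using freq unfolding frequently_sequentially by blast
    with card_mono[OF fin C_sub[of n]] show False by linarith
  qed
  then have ord: "greedy_seq T v \<in> connected_orderings T"
    using assms(1) by (rule greedy_seq_connected_ordering[rotated])
  then have inj: "inj (greedy_seq T v)"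
    by (simp add: connected_orderings_def bij_betw_def)
  have count: "card (?C n) \<le> prefix_count (greedy_seq T v) n" if "n \<ge> v" for n
  proof (rule prefix_count_ge[OF inj])
    have "?C n \<subseteq> {1..n}"
    proof
      fix x assume "x \<in> ?C n"
      then have "x \<le> n" "x \<in> verts T"
        using component_initial_subset[OF that] C_sub by blast+
      moreover have "x \<noteq> 0" using \<open>x \<in> verts T\<close> assms(2) by metis
      ultimately show "x \<in> {1..n}" by simp
    qed
    then show "greedy_seq T v ` {..<card (?C n)} \<subseteq> {1..n}"
      using that by (simp add: greedy_seq_image greedy_set_eq_component)
  qed
  have "seq_strong_upper_density (greedy_seq T v) \<ge> 1 / 2"
  proof (rule ccontr)
    assume "\<not> ?thesis"
    then have "\<forall>\<^sub>F n in sequentially.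
        ereal (real (prefix_count (greedy_seq T v) n) / real n) < 1 / 2"
      unfolding seq_strong_upper_density_def by (intro Limsup_lessD) auto
    then have "\<forall>\<^sub>F n in sequentially. \<not> n \<le> 2 * card (?C n)"
      \<comment> \<open>\<open>Suc v\<close> gives both \<open>v \<le> n\<close>, needed for
        \<open>count\<close>, and \<open>n > 0\<close>, needed to clear the denominator.\<close>
      using eventually_ge_at_top[of "Suc v"]
    proof eventually_elim
      case (elim n)
      have "(1 / 2 :: ereal) = ereal (1 / 2)"
        by (metis ereal_divide one_ereal_def numeral_eq_ereal zero_neq_numeral)
      then have "real (prefix_count (greedy_seq T v) n) / real n < 1 / 2" using elim by simp
      then have "2 * prefix_count (greedy_seq T v) n < n" using elim by (simp add: field_simps)
      then show ?case using count[of n] elim by linarith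
    qed
    with freq show False by (simp add: frequently_def)
  qed
  then show ?thesis unfolding strong_upper_density_def by (rule SUP_upper2[OF ord])
qed

section \<open>Colour classes and their components\<close>

definition color_class :: "(nat set \<Rightarrow> nat) \<Rightarrow> nat \<Rightarrow> nat graph" where
  "color_class c i = (verts K_nat, {e \<in> edges K_nat. c e = i})"

lemma adj_color_class:
  "(x, y) \<in> adj (color_class c i) \<longleftrightarrow> 1 \<le> x \<and> 1 \<le> y \<and> x \<noteq> y \<and> c {x, y} = i"
  by (auto simp: adj_def color_class_def K_nat_def complete_graph_def card_2_iff doubleton_eq_iff)

text \<open>Restricting to \<open>{..n}\<close> has the effect of restricting to
  \<open>{1..n}\<close>, since 0 is an end of no edge of a colour class.\<close>

abbreviation color_component :: "(nat set \<Rightarrow> nat) \<Rightarrow> nat \<Rightarrow> nat \<Rightarrow> nat \<Rightarrow> nat set" where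
  "color_component c i n v \<equiv> component (induced_subgraph (color_class c i) {..n}) v"

lemma color_component_adj:
  assumes "x \<in> color_component c i n v" "x \<in> {1..n}" "y \<in> {1..n}" "x \<noteq> y" "c {x, y} = i"
  shows "y \<in> color_component c i n v"
  using assms by (intro component_adj[OF assms(1)]) (simp add: adj_induced_subgraph adj_color_class)

lemma color_component_subset:
  assumes "v \<in> {1..n}"
  shows "color_component c i n v \<subseteq> {1..n}"
  by (rule component_subset) (use assms in \<open>auto simp: adj_induced_subgraph adj_color_class\<close>)

lemma color_component_mono:
  "m \<le> n \<Longrightarrow> color_component c i m v \<subseteq> color_component c i n v"
  by (rule component_mono) (auto simp: adj_induced_subgraph)

text \<open>The witness is induced on the whole component of \<open>v\<close> in its colour class.
  Its components of \<open>v\<close> within \<open>{..n}\<close> are at least as large as those of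
  the colour class, so the frequent bound carries over.\<close>

lemma dense_component_imp_dense_subgraph:
  assumes "1 \<le> v" "\<exists>\<^sub>F n in sequentially. n \<le> 2 * card (color_component c i n v)"
  shows "\<exists>T. is_subgraph T K_nat \<and> connected_graph T \<and> monochromatic c T \<and>
             strong_upper_density T \<ge> 1 / 2"
proof -
  let ?G = "color_class c i"
  let ?T = "induced_subgraph ?G (component ?G v)"
  have pos: "component ?G v \<subseteq> {n. n \<ge> 1}"
    by (rule component_subset) (use assms(1) in \<open>auto simp: adj_color_class\<close>)
  then have V: "verts ?T = component ?G v"
    by (auto simp: induced_subgraph_def color_class_def K_nat_def complete_graph_def)
  have "component ?G v \<subseteq> component ?T v"
    by (rule component_subset_restrict[of _ ?G]) (auto simp: adj_induced_subgraph)
  moreover have "component ?T v \<subseteq> component ?G v"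
    by (rule component_mono) (auto simp: adj_induced_subgraph)
  ultimately have V': "verts ?T = component ?T v" using V by blast
  have fin: "finite (component (induced_subgraph ?T {..n}) v)" if "v \<le> n" for n
    using component_initial_subset[OF that] finite_subset by blast
  have le: "card (color_component c i n v) \<le> card (component (induced_subgraph ?T {..n}) v)"
    if "v \<le> n" for n
    by (intro card_mono fin[OF that] component_subset_restrict[of _ ?G])
      (auto simp: adj_induced_subgraph)
  have "\<exists>\<^sub>F n in sequentially. n \<le> 2 * card (component (induced_subgraph ?T {..n}) v)"
    using frequently_eventually_frequently[OF assms(2) eventually_ge_at_top[of v]]
    by (rule frequently_elim1) (use le in force)
  moreover have "0 \<notin> verts ?T" using V pos by auto
  ultimately have "strong_upper_density ?T \<ge> 1 / 2"
    using V' by (intro strong_upper_density_ge_half)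
  moreover have "connected_graph ?T"
    using V' by (intro connected_graphI[of v]) (auto simp: self_in_component)
  moreover have "is_subgraph ?T K_nat"
    by (auto simp: is_subgraph_def simple_graph_def induced_subgraph_def color_class_def
        K_nat_def complete_graph_def)
  moreover have "monochromatic c ?T"
    by (auto simp: monochromatic_def induced_subgraph_def color_class_def)
  ultimately show ?thesis by (intro exI[of _ ?T] conjI)
qed

section \<open>The argument with three colours\<close>

lemma edge_coloring_3_cases:
  assumes "edge_coloring 3 K_nat c" "1 \<le> x" "1 \<le> y" "x \<noteq> y"
  shows "c {x, y} = 1 \<or> c {x, y} = 2 \<or> c {x, y} = 3"
proof -
  have "{x, y} \<in> edges K_nat" using assms by (auto simp: K_nat_def complete_graph_def)
  then have "c {x, y} \<in> {1..3}" using assms(1) by (auto simp: edge_coloring_def)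
  then show ?thesis by auto
qed

text \<open>Colour 3 contains a complete bipartite graph on the complement of the third component.
  Both sides are nonempty, so it is connected.\<close>

lemma complement_in_color_component:
  assumes col: "edge_coloring 3 K_nat c" and v: "v \<in> {1..n}"
    and small: "\<And>i. i \<in> {1, 2, 3} \<Longrightarrow> 2 * card (color_component c i n v) < n"
    and u: "u \<in> {1..n} - color_component c 3 n v"
  shows "{1..n} - color_component c 3 n v \<subseteq> color_component c 3 n u"
proof
  fix w assume w: "w \<in> {1..n} - color_component c 3 n v"
  let ?A = "\<lambda>i. color_component c i n v"
  have cases3: "c {x, y} = 1 \<or> c {x, y} = 2 \<or> c {x, y} = 3"
    if "x \<in> {1..n}" "y \<in> {1..n}" "x \<noteq> y" for x y
    using edge_coloring_3_cases[OF col] that by auto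
  have cover: "x \<in> ?A 1 \<union> ?A 2 \<union> ?A 3" if "x \<in> {1..n}" for x
  proof (cases "x = v")
    case False
    then show ?thesis
      using cases3[OF v that] color_component_adj[OF self_in_component v that] by blast
  qed (simp add: self_in_component)
  have closed: "(x \<in> ?A i \<longleftrightarrow> y \<in> ?A i)"
    if "x \<in> {1..n}" "y \<in> {1..n}" "x \<noteq> y" "c {x, y} = i" for x y i
    using color_component_adj[of x c i n v y] color_component_adj[of y c i n v x] that
    by (auto simp: insert_commute)
  have miss: "\<exists>z\<in>{1..n}. z \<notin> ?A i \<union> ?A j" if "i \<in> {1, 2, 3}" "j \<in> {1, 2, 3}" for i j
  proof (rule ccontr)
    assume "\<not> ?thesis"
    then have "{1..n} \<subseteq> ?A i \<union> ?A j" by blast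
    moreover have "finite (?A i \<union> ?A j)"
      using color_component_subset[OF v] by (meson finite_UnI finite_atLeastAtMost finite_subset)
    ultimately have "card {1..n} \<le> card (?A i \<union> ?A j)" by (intro card_mono)
    also have "\<dots> \<le> card (?A i) + card (?A j)" by (rule card_Un_le)
    finally show False using small[OF that(1)] small[OF that(2)] by simp
  qed
  obtain z where z: "z \<in> {1..n}" "z \<notin> ?A 1" "z \<notin> ?A 2" using miss[of 1 2] by auto
  \<comment> \<open>If \<open>x\<close> were in both \<open>?A 1\<close> and \<open>?A 2\<close>, no
    colour would be left for the edge to \<open>z\<close>: colours 1 and 2 would draw
    \<open>z\<close> into \<open>?A 1\<close> or \<open>?A 2\<close>, and colour 3 would draw
    \<open>x\<close> into \<open>?A 3\<close>.\<close>
  have split: "x \<in> ?A 1 \<longleftrightarrow> x \<notin> ?A 2" if x: "x \<in> {1..n} - ?A 3" for x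
  proof -
    have "z \<in> ?A 3" using cover z by blast
    then have "x \<noteq> z" using x by blast
    with cases3[of x z] closed[of x z] x z \<open>z \<in> ?A 3\<close> have "x \<notin> ?A 1 \<or> x \<notin> ?A 2" by blast
    then show ?thesis using cover x by blast
  qed
  have cross: "c {x, y} = 3"
    if "x \<in> {1..n} - ?A 3" "y \<in> {1..n} - ?A 3" "x \<in> ?A 1 \<longleftrightarrow> y \<notin> ?A 1" for x y
    using cases3[of x y] closed[of x y] split[of x] split[of y] that by blast
  have join: "y \<in> color_component c 3 n w'"
    if "x \<in> {1..n} - ?A 3" "y \<in> {1..n} - ?A 3" "x \<in> ?A 1 \<longleftrightarrow> y \<notin> ?A 1"
       "x \<in> color_component c 3 n w'" for x y w'
    using color_component_adj[OF that(4)] cross[OF that(1-3)] that by blast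
  \<comment> \<open>\<open>p\<close> and \<open>q\<close> show that both sides of the bipartition
    are nonempty.\<close>
  obtain p where p: "p \<in> {1..n}" "p \<notin> ?A 2" "p \<notin> ?A 3" using miss[of 2 3] by auto
  obtain q where q: "q \<in> {1..n}" "q \<notin> ?A 1" "q \<notin> ?A 3" using miss[of 1 3] by auto
  have "p \<in> ?A 1" using split[of p] p by blast
  \<comment> \<open>\<open>r\<close> lies on the side opposite to \<open>u\<close>. It is the middle
    vertex of a path from \<open>u\<close> to any \<open>w\<close> on the side of
    \<open>u\<close>.\<close>
  then obtain r where r: "r \<in> {1..n} - ?A 3" "u \<in> ?A 1 \<longleftrightarrow> r \<notin> ?A 1"
    using p q by blast
  show "w \<in> color_component c 3 n u"
  proof (cases "u \<in> ?A 1 \<longleftrightarrow> w \<in> ?A 1")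
    case True
    then show ?thesis
      using join[OF u r self_in_component] join[of r w u] r w by blast
  next
    case False
    then show ?thesis using join[OF u w _ self_in_component] by blast
  qed
qed

theorem theorem1p12:
  fixes c :: "nat set \<Rightarrow> nat"
  assumes "edge_coloring 3 K_nat c"
  shows "\<exists>T. is_subgraph T K_nat \<and> connected_graph T \<and> monochromatic c T \<and>
             strong_upper_density T \<ge> 1 / 2"
proof (cases "\<exists>i\<in>{1, 2, 3}. \<exists>\<^sub>F n in sequentially. n \<le> 2 * card (color_component c i n 1)")
  case True
  then show ?thesis using dense_component_imp_dense_subgraph[of 1] by blast
next
  case False
  then have "\<forall>\<^sub>F n in sequentially. \<forall>i\<in>{1, 2, 3}. 2 * card (color_component c i n 1) < n"
    by (simp add: not_frequently not_le eventually_conj_iff)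
  then obtain N where N: "\<And>n i. n \<ge> N \<Longrightarrow> i \<in> {1, 2, 3} \<Longrightarrow> 2 * card (color_component c i n 1) < n"
    unfolding eventually_sequentially by blast
  let ?A = "\<lambda>n. color_component c 3 n 1"
  \<comment> \<open>The strict bound excludes \<open>n = 0\<close>, so the vertex 1 belongs to
    \<open>{1..n}\<close>.\<close>
  have pos: "1 \<le> n" if "n \<ge> N" for n using N[OF that, of 1] by simp
  have fin: "finite (color_component c 3 n v)" if "v \<in> {1..n}" for n v
    using color_component_subset[OF that] by (rule finite_subset) simp
  obtain u where u: "u \<in> {1..N} - ?A N"
  proof -
    have "card (?A N) < card {1..N}" using N[of N 3] by simp
    moreover have "finite (?A N)" using fin pos by simp
    ultimately have "\<not> {1..N} \<subseteq> ?A N" using card_mono by (metis not_le)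
    then show ?thesis using that by blast
  qed
  have complement: "{1..n} - ?A n \<subseteq> color_component c 3 n u" if "n \<ge> N" "u \<notin> ?A n" for n
    using assms pos N u that by (intro complement_in_color_component) auto
  have outside: "u \<notin> ?A n" if "n \<ge> N" for n
    using that
  proof (induction rule: dec_induct)
    case base
    then show ?case using u by blast
  next
    case (step n)
    show ?case
    proof
      assume "u \<in> ?A (Suc n)"
      then have "color_component c 3 (Suc n) u \<subseteq> ?A (Suc n)" by (rule component_trans)
      \<comment> \<open>The old \<open>?A n\<close> persists by monotonicity, and the rest of
        \<open>{1..n}\<close> comes along with the component of \<open>u\<close>. This gives
        \<open>2 * n < n + 1\<close>, which contradicts \<open>1 \<le> n\<close>.\<close>
      then have "{1..n} \<subseteq> ?A (Suc n)"
        using complement[OF step(1,3)] color_component_mono[of n "Suc n" c 3] by fastforce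
      then have "card {1..n} \<le> card (?A (Suc n))" using fin by (intro card_mono) auto
      then show False using N[of "Suc n" 3] step(1) pos[OF step(1)] by simp
    qed
  qed
  have "n \<le> 2 * card (color_component c 3 n u)" if n: "n \<ge> N" for n
  proof -
    have "card ({1..n} - ?A n) \<le> card (color_component c 3 n u)"
      using complement[OF n outside[OF n]] fin u n by (intro card_mono) auto
    moreover have "card {1..n} - card (?A n) \<le> card ({1..n} - ?A n)"
      by (intro diff_card_le_card_Diff) (use fin pos n in auto)
    ultimately show ?thesis using N[OF n, of 3] by simp
  qed
  then have "\<forall>\<^sub>F n in sequentially. n \<le> 2 * card (color_component c 3 n u)"
    unfolding eventually_sequentially by blast
  then have "\<exists>\<^sub>F n in sequentially. n \<le> 2 * card (color_component c 3 n u)"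
    by (rule eventually_frequently[rotated]) simp
  then show ?thesis using u by (intro dense_component_imp_dense_subgraph[of u]) auto
qed

end
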